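(* Let $q=p^n$ with $p$ a prime number and $n\ge 1$, and let $0\le e<n$. Let $f_e$ be an $e$-Klenian polynomial over $\mathbb{F}_q$, with permutation polynomial tuple $\underline{\beta}_{f_e}=(\beta_0,\beta_1,\ldots,\beta_{q-1})\in \mathfrak{S}_q^{q}$. Then there are exactly $q!$ permutation group polynomials over $\mathbb{F}_q$ that are equivalent to $f_e$.
   Context: Let $\mathbb{F}_q = \{c_0, \ldots, c_{q-1}\}$ be a fixed listing, and let $\mathfrak{S}_q$ be the symmetric group on the set $\mathbb{F}_q$ (products are compositions). Polynomials over $\mathbb{F}_q$ are taken with degree less than $q$ in each variable, i.e. identified with functions. A polynomial $f\in\mathbb{F}_q[X_1,X_2]$ is a local permutation polynomial (LPP) if $f(a,X_2)$ and $f(X_1,a)$ are permutation polynomials of $\mathbb{F}_q$ for every $a\in\mathbb{F}_q$. LPPs correspond bijectively to permutation polynomial tuples, i.e. (ordered) tuples $\underline{\beta}_f=(\beta_0,\ldots,\beta_{q-1})\in\mathfrak{S}_q^q$ such that $\beta_i\beta_j^{-1}$ has no fixed points for $i\ne j$, via $f(x,\beta_i(x))=c_i$ for all $x\in\mathbb{F}_q$ and all $i$. If $\{\beta_0,\ldots,\beta_{q-1}\}$ is a subgroup of $\mathfrak{S}_q$, then $f$ is called a permutation group polynomial and this subgroup is its associated group. Two permutation polynomial tuples $\Omega=(\beta_0,\ldots,\beta_{q-1})$ and $\Gamma=(\gamma_0,\ldots,\gamma_{q-1})$ are equivalent if there exist $\sigma,\lambda\in\mathfrak{S}_q$ with $\sigma\Omega\lambda=\Gamma$,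 i.e. $\sigma\beta_i\lambda=\gamma_i$ for all $i$; two LPPs are equivalent if their tuples are. For $0\le e<n$ put $\ell=p^e$, $t=q/\ell$, and let $G=\langle a,b\rangle=\{a^{i}b^{j}: 0\le i\le \ell-1,\ 0\le j\le t-1\}<\mathfrak{S}_q$, where $a=\prod_{i=0}^{t-1}(c_{i\ell},c_{i\ell+1},\ldots,c_{(i+1)\ell-1})$ and $b=\prod_{j=0}^{\ell-1}(c_j,c_{j+\ell},\ldots,c_{j+(t-1)\ell})$. This $G$ is a subgroup of order $q$ in which no non-identity element has a fixed point. An $e$-Klenian polynomial over $\mathbb{F}_q$ is a permutation group polynomial of this form, i.e. one whose associated group (a subgroup of $\mathfrak{S}_q$) is isomorphic to $G$. *)

theory Defs
  imports
    "HOL-Algebra.Bij"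
    "HOL-Algebra.Generated_Groups"
    "HOL-Combinatorics.Cycles"
    "HOL-Computational_Algebra.Polynomial"
    "HOL-Computational_Algebra.Primes"
    "HOL-Library.Cardinality"
begin

text \<open>The finite field \<open>F_q\<close> is a type \<open>'a :: {field, finite}\<close>, with \<open>q = CARD('a)\<close>; its listing
  \<open>c_0, ..., c_{q-1}\<close> is a function \<open>c :: nat \<Rightarrow> 'a\<close> that is bijective from \<open>{..<q}\<close> onto the type.
  The symmetric group on \<open>F_q\<close> is \<open>BijGroup UNIV\<close>, whose product is composition.\<close>

abbreviation Sym :: "('a \<Rightarrow> 'a) monoid" where
  "Sym \<equiv> BijGroup UNIV"

text \<open>An element of \<open>'a poly poly\<close> is a bivariate polynomial: the outer variable is \<open>X_2\<close>, and the
  coefficients are polynomials in \<open>X_1\<close>.\<close>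

definition eval2 :: "'a::comm_ring_1 poly poly \<Rightarrow> 'a \<Rightarrow> 'a \<Rightarrow> 'a" where
  "eval2 f x y = poly (poly f [:y:]) x"

definition subst_fst :: "'a::comm_ring_1 poly poly \<Rightarrow> 'a \<Rightarrow> 'a poly" where
  "subst_fst f a = map_poly (\<lambda>g. poly g a) f"

definition subst_snd :: "'a::comm_ring_1 poly poly \<Rightarrow> 'a \<Rightarrow> 'a poly" where
  "subst_snd f a = poly f [:a:]"

definition reduced :: "'a::{field,finite} poly poly \<Rightarrow> bool" where
  "reduced f \<longleftrightarrow> degree f < CARD('a) \<and> (\<forall>k. degree (coeff f k) < CARD('a))"

definition perm_poly :: "'a::{field,finite} poly \<Rightarrow> bool" where
  "perm_poly g \<longleftrightarrow> bij (poly g)"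

definition lpp :: "'a::{field,finite} poly poly \<Rightarrow> bool" where
  "lpp f \<longleftrightarrow> reduced f \<and> (\<forall>a. perm_poly (subst_fst f a) \<and> perm_poly (subst_snd f a))"

definition perm_poly_tuple :: "('a::finite \<Rightarrow> 'a) list \<Rightarrow> bool" where
  "perm_poly_tuple \<Omega> \<longleftrightarrow> length \<Omega> = CARD('a) \<and> (\<forall>\<beta>\<in>set \<Omega>. bij \<beta>) \<and>
     (\<forall>i<CARD('a). \<forall>j<CARD('a). i \<noteq> j \<longrightarrow> (\<forall>x. (\<Omega> ! i \<circ> inv_into UNIV (\<Omega> ! j)) x \<noteq> x))"

text \<open>The tuple of an LPP \<open>f\<close>: its \<open>i\<close>-th entry maps \<open>x\<close> to the unique \<open>y\<close> with \<open>f(x, y) = c_i\<close>.\<close>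

definition tuple_of :: "(nat \<Rightarrow> 'a) \<Rightarrow> 'a::{field,finite} poly poly \<Rightarrow> ('a \<Rightarrow> 'a) list" where
  "tuple_of c f = map (\<lambda>i x. THE y. eval2 f x y = c i) [0..<CARD('a)]"

definition tuple_equiv :: "('a::finite \<Rightarrow> 'a) list \<Rightarrow> ('a \<Rightarrow> 'a) list \<Rightarrow> bool" where
  "tuple_equiv \<Omega> \<Gamma> \<longleftrightarrow> perm_poly_tuple \<Omega> \<and> perm_poly_tuple \<Gamma> \<and>
     (\<exists>\<sigma> \<mu>. bij \<sigma> \<and> bij \<mu> \<and> map (\<lambda>\<beta>. \<sigma> \<circ> \<beta> \<circ> \<mu>) \<Omega> = \<Gamma>)"

definition lpp_equiv ::
  "(nat \<Rightarrow> 'a) \<Rightarrow> 'a::{field,finite} poly poly \<Rightarrow> 'a poly poly \<Rightarrow> bool" where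
  "lpp_equiv c f g \<longleftrightarrow> lpp f \<and> lpp g \<and> tuple_equiv (tuple_of c f) (tuple_of c g)"

definition perm_group_poly :: "(nat \<Rightarrow> 'a) \<Rightarrow> 'a::{field,finite} poly poly \<Rightarrow> bool" where
  "perm_group_poly c f \<longleftrightarrow> lpp f \<and> subgroup (set (tuple_of c f)) Sym"

text \<open>With \<open>l = p^e\<close> and \<open>t = q/l\<close>, these are the permutations \<open>a\<close> and \<open>b\<close>: products of disjoint
  cycles whose supports are, respectively, blocks of \<open>l\<close> consecutive indices and residue classes of
  indices modulo \<open>l\<close>.\<close>

definition klenian_a :: "(nat \<Rightarrow> 'a) \<Rightarrow> nat \<Rightarrow> nat \<Rightarrow> 'a \<Rightarrow> 'a" where
  "klenian_a c l t =
     foldr (\<lambda>i \<pi>. cycle_of_list (map (\<lambda>k. c (i * l + k)) [0..<l]) \<circ> \<pi>) [0..<t] id"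

definition klenian_b :: "(nat \<Rightarrow> 'a) \<Rightarrow> nat \<Rightarrow> nat \<Rightarrow> 'a \<Rightarrow> 'a" where
  "klenian_b c l t =
     foldr (\<lambda>j \<pi>. cycle_of_list (map (\<lambda>k. c (j + k * l)) [0..<t]) \<circ> \<pi>) [0..<l] id"

definition klenian_group :: "(nat \<Rightarrow> 'a) \<Rightarrow> nat \<Rightarrow> nat \<Rightarrow> ('a \<Rightarrow> 'a) set" where
  "klenian_group c l t = generate Sym {klenian_a c l t, klenian_b c l t}"

definition klenian ::
  "(nat \<Rightarrow> 'a) \<Rightarrow> nat \<Rightarrow> nat \<Rightarrow> 'a::{field,finite} poly poly \<Rightarrow> bool" where
  "klenian c p e f \<longleftrightarrow> perm_group_poly c f \<and>
     Sym\<lparr>carrier := set (tuple_of c f)\<rparr> \<cong>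
     Sym\<lparr>carrier := klenian_group c (p ^ e) (CARD('a) div p ^ e)\<rparr>"

lemma poly_subst_fst: "poly (subst_fst f x) y = eval2 f x y"
  unfolding subst_fst_def eval2_def
  by (induction f) (simp_all add: map_poly_pCons algebra_simps)

lemma poly_subst_snd: "poly (subst_snd f y) x = eval2 f x y"
  by (simp add: subst_snd_def eval2_def)

lemma eval2_tuple_of:
  fixes f :: "'a::{field,finite} poly poly"
  assumes "lpp f" and "i < CARD('a)"
  shows "eval2 f x y = c i \<longleftrightarrow> y = (tuple_of c f ! i) x"
proof -
  have "bij (eval2 f x)"
    using assms(1) ext[of "poly (subst_fst f x)" "eval2 f x", OF poly_subst_fst]
    by (metis lpp_def perm_poly_def)
  then have "\<exists>!y. eval2 f x y = c i" by (simp add: bij_iff)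
  then have "eval2 f x y = c i \<longleftrightarrow> y = (THE y. eval2 f x y = c i)"
    using theI'[of "\<lambda>y. eval2 f x y = c i"] the1_equality[of "\<lambda>y. eval2 f x y = c i" y] by blast
  then show ?thesis using assms(2) by (simp add: tuple_of_def)
qed

lemma perm_poly_tuple_tuple_of:
  fixes f :: "'a::{field,finite} poly poly"
  assumes f: "lpp f" and c: "bij_betw c {..<CARD('a)} UNIV"
  shows "perm_poly_tuple (tuple_of c f)"
proof -
  note E = eval2_tuple_of[OF f, where c = c]
  have len: "length (tuple_of c f) = CARD('a)" by (simp add: tuple_of_def)
  have inj2: "inj (\<lambda>x. eval2 f x y)" for y
    using f ext[of "poly (subst_snd f y)" "\<lambda>x. eval2 f x y", OF poly_subst_snd]
    by (metis lpp_def perm_poly_def bij_is_inj)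
  have bij: "bij (tuple_of c f ! i)" if "i < CARD('a)" for i
  proof -
    have "inj (tuple_of c f ! i)"
    proof (rule injI)
      fix x x' assume "(tuple_of c f ! i) x = (tuple_of c f ! i) x'"
      then have "eval2 f x ((tuple_of c f ! i) x) = eval2 f x' ((tuple_of c f ! i) x)"
        using E[OF that, of x "(tuple_of c f ! i) x"] E[OF that, of x' "(tuple_of c f ! i) x"] by simp
      then show "x = x'" using injD[OF inj2] by blast
    qed
    then show ?thesis by (simp add: bij_def finite_UNIV_inj_surj)
  qed
  have "(tuple_of c f ! i \<circ> inv_into UNIV (tuple_of c f ! j)) x \<noteq> x"
    if ij: "i < CARD('a)" "j < CARD('a)" "i \<noteq> j" for i j x
  proof
    let ?x = "inv_into UNIV (tuple_of c f ! j) x"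
    assume "(tuple_of c f ! i \<circ> inv_into UNIV (tuple_of c f ! j)) x = x"
    moreover have "(tuple_of c f ! j) ?x = x" using bij[OF ij(2)] by (simp add: bij_is_surj surj_f_inv_f)
    ultimately have "c i = c j" using E[OF ij(1), of ?x x] E[OF ij(2), of ?x x] by simp
    then show False using c ij by (auto simp: bij_betw_def inj_on_def)
  qed
  then show ?thesis using bij len by (auto simp: perm_poly_tuple_def in_set_conv_nth)
qed

end

theory Submission
  imports Defs
begin

text \<open>Only the fact that the associated group \<open>H = {\<beta>_0, ..., \<beta>_{q-1}}\<close> is sharply transitive
  matters. The map \<open>g \<mapsto> g(0, X_2)\<close> is a bijection from the permutation group polynomials equivalent
  to \<open>f\<close> onto the permutations of the field. It is injective because a tuple
  \<open>\<gamma>_i = \<sigma> \<beta>_i \<mu>\<close> that forms a group satisfies \<open>\<gamma>_i \<gamma>_j = \<gamma>_k\<close>, where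
  \<open>\<beta>_k = \<beta>_i \<beta>_m\<^sup>-\<^sup>1 \<beta>_j\<close> and \<open>\<gamma>_m\<close> is the identity; hence \<open>\<gamma>_i\<close> sends \<open>\<gamma>_j(0)\<close> to \<open>\<gamma>_k(0)\<close>, and
  the orbit of \<open>0\<close> determines the tuple. It is surjective because for a permutation \<open>\<pi>\<close> with
  \<open>\<pi>(0) = c_m\<close> the permutation \<open>\<nu>\<close> that sends \<open>\<beta>_m\<^sup>-\<^sup>1 \<beta>_i(0)\<close> to \<open>\<pi>\<^sup>-\<^sup>1(c_i)\<close> fixes \<open>0\<close>, so that the
  tuple \<open>\<nu> \<beta>_m\<^sup>-\<^sup>1 \<beta>_i \<nu>\<^sup>-\<^sup>1\<close> is the one of a polynomial \<open>g\<close> with \<open>g(0, X_2) = \<pi>\<close>.\<close>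

section \<open>Interpolation in one and two variables over a finite field\<close>

text \<open>Lagrange interpolation at all points of the field: \<open>L a\<close> is a product of
  linear factors over the q - 1 points other than \<open>a\<close>, which bounds its degree by q -
  1.\<close>

lemma ex_interpolating_poly:
  fixes h :: "'a::{field,finite} \<Rightarrow> 'a"
  shows "\<exists>p. degree p < CARD('a) \<and> poly p = h"
proof -
  define L :: "'a \<Rightarrow> 'a poly" where
    "L a = (\<Prod>b\<in>UNIV - {a}. smult (inverse (a - b)) [:- b, 1:])" for a
  have L: "poly (L a) x = (if x = a then 1 else 0)" for a x
  proof (cases "x = a")
    case True
    have "poly (L a) a = (\<Prod>b\<in>UNIV - {a}. 1)"
      unfolding L_def poly_prod
      by (rule prod.cong) (auto simp del: smult_pCons)
    then show ?thesis using True by simp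
  next
    case False
    have "poly (L a) x = 0"
      unfolding L_def poly_prod using False by (intro prod_zero) auto
    then show ?thesis using False by simp
  qed
  have deg: "degree (L a) \<le> CARD('a) - 1" for a
  proof -
    have "degree (L a) \<le> (\<Sum>b\<in>UNIV - {a}. degree (smult (inverse (a - b)) [:- b, 1:]))"
      unfolding L_def by (rule order.trans[OF degree_prod_sum_le]) (auto simp: o_def)
    also have "\<dots> \<le> (\<Sum>b\<in>UNIV - {a}. 1)"
      by (rule sum_mono) auto
    finally show ?thesis by simp
  qed
  let ?p = "\<Sum>a\<in>UNIV. smult (h a) (L a)"
  have "degree ?p \<le> CARD('a) - 1"
    by (intro degree_sum_le order.trans[OF degree_smult_le deg] finite order.refl)
  moreover have "0 < CARD('a)" by simp
  ultimately have "degree ?p < CARD('a)" by linarith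
  moreover have "poly ?p = h"
    by (rule ext) (simp add: poly_sum L if_distrib cong: if_cong)
  ultimately show ?thesis by blast
qed

text \<open>Interpolation is applied twice: \<open>R x\<close> interpolates \<open>F x\<close> in
  the second variable, and \<open>C k\<close> then interpolates the k-th coefficient of
  \<open>R x\<close> as a function of \<open>x\<close>.\<close>

lemma ex_reduced_eval2:
  fixes F :: "'a::{field,finite} \<Rightarrow> 'a \<Rightarrow> 'a"
  shows "\<exists>f. reduced f \<and> eval2 f = F"
proof -
  have "\<forall>x. \<exists>p. degree p < CARD('a) \<and> poly p = F x"
    by (intro allI ex_interpolating_poly)
  from choice[OF this] obtain R
    where R: "\<And>x. degree (R x) < CARD('a)" "\<And>x. poly (R x) = F x"
    by blast
  have "\<forall>k. \<exists>p. degree p < CARD('a) \<and> poly p = (\<lambda>x. coeff (R x) k)"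
    by (intro allI ex_interpolating_poly)
  from choice[OF this] obtain C
    where C: "\<And>k. degree (C k) < CARD('a)" "\<And>k. poly (C k) = (\<lambda>x. coeff (R x) k)"
    by blast
  let ?f = "\<Sum>k<CARD('a). monom (C k) k"
  have "degree ?f \<le> CARD('a) - 1"
    by (rule degree_sum_le) (auto intro: order.trans[OF degree_monom_le])
  moreover have "0 < CARD('a)" by simp
  ultimately have "degree ?f < CARD('a)" by linarith
  moreover have "degree (coeff ?f k) < CARD('a)" for k
    by (simp add: coeff_sum C if_distrib[of degree] cong: if_cong)
  moreover have "eval2 ?f x y = F x y" for x y
  proof -
    have "eval2 ?f x y = (\<Sum>k<CARD('a). coeff (R x) k * y ^ k)"
      by (simp add: eval2_def poly_sum poly_monom C)
    also have "\<dots> = (\<Sum>k\<le>degree (R x). coeff (R x) k * y ^ k)"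
      using R(1)[of x] by (intro sum.mono_neutral_right) (auto simp: coeff_eq_0)
    finally show ?thesis using R(2)[of x] by (simp flip: poly_altdef)
  qed
  ultimately show ?thesis unfolding reduced_def by blast
qed

text \<open>A univariate polynomial of degree below q is determined by its q values. This is used
  first in \<open>X_2\<close> with \<open>x\<close> fixed, then in \<open>X_1\<close> for each
  coefficient.\<close>

lemma reduced_eqI:
  fixes f g :: "'a::{field,finite} poly poly"
  assumes "reduced f" "reduced g" "eval2 f = eval2 g"
  shows "f = g"
proof -
  have eqI: "p = r" if "degree p < CARD('a)" "degree r < CARD('a)" "poly p = poly r"
    for p r :: "'a poly"
    using that by (intro poly_eqI_degree[of UNIV]) auto
  have deg: "degree (subst_fst h x) < CARD('a)" if "reduced h" for h :: "'a poly poly" and x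
    unfolding subst_fst_def using that map_poly_degree_leq[of "\<lambda>g. poly g x" h]
    by (auto simp: reduced_def)
  have "subst_fst f x = subst_fst g x" for x
    using assms by (intro eqI deg) (auto simp: poly_subst_fst)
  then have "poly (coeff f k) x = poly (coeff g k) x" for k x
    by (metis coeff_map_poly poly_0 subst_fst_def)
  then have "coeff f k = coeff g k" for k
    using assms by (intro eqI) (auto simp: reduced_def)
  then show ?thesis by (rule poly_eqI)
qed

section \<open>Sharply transitive tuples and local permutation polynomials\<close>

text \<open>The fixed-point condition says that distinct entries agree at no point, so
  \<open>i\<close> is sent injectively to the value of the i-th entry at \<open>x\<close>. With q
  indices and q points, injective means bijective. Below, tuples are used in this sharply transitive
  form.\<close>

lemma perm_poly_tuple_iff:
  fixes \<Omega> :: "('a::finite \<Rightarrow> 'a) list"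
  shows "perm_poly_tuple \<Omega> \<longleftrightarrow> length \<Omega> = CARD('a) \<and> (\<forall>\<beta>\<in>set \<Omega>. bij \<beta>) \<and>
    (\<forall>x. bij_betw (\<lambda>i. (\<Omega> ! i) x) {..<CARD('a)} UNIV)"
proof (cases "length \<Omega> = CARD('a) \<and> (\<forall>\<beta>\<in>set \<Omega>. bij \<beta>)")
  case True
  then have b: "bij (\<Omega> ! i)" if "i < CARD('a)" for i using that by auto
  \<comment> \<open>Replace \<open>x\<close> by its image under \<open>\<Omega> ! j\<close>.\<close>
  have "(\<forall>x. (\<Omega> ! i \<circ> inv_into UNIV (\<Omega> ! j)) x \<noteq> x) \<longleftrightarrow> (\<forall>x. (\<Omega> ! i) x \<noteq> (\<Omega> ! j) x)"
    if "j < CARD('a)" for i j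
    using b[OF that] by (metis bij_inv_eq_iff comp_apply)
  then have "perm_poly_tuple \<Omega> \<longleftrightarrow> (\<forall>x. inj_on (\<lambda>i. (\<Omega> ! i) x) {..<CARD('a)})"
    using True by (auto simp: perm_poly_tuple_def inj_on_def) blast+
  moreover have "inj_on h {..<CARD('a)} \<longleftrightarrow> bij_betw h {..<CARD('a)} UNIV" for h :: "nat \<Rightarrow> 'a"
    by (metis bij_betw_def card_image card_lessThan finite_code card_eq_UNIV_imp_eq_UNIV)
  ultimately show ?thesis using True by blast
qed (auto simp: perm_poly_tuple_def)

text \<open>Let \<open>g\<close> take at (x, y) the value \<open>c i\<close> for the unique
  \<open>i\<close> whose entry maps x to y. Sharp transitivity makes \<open>g\<close> bijective in
  y, and injectivity of each entry makes it bijective in x.\<close>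

lemma ex_lpp_tuple_of:
  fixes \<Omega> :: "('a::{field,finite} \<Rightarrow> 'a) list"
  assumes \<Omega>: "perm_poly_tuple \<Omega>" and c: "bij_betw c {..<CARD('a)} UNIV"
  shows "\<exists>g. lpp g \<and> tuple_of c g = \<Omega>"
proof -
  let ?q = "CARD('a)"
  have len: "length \<Omega> = ?q" and bij: "\<And>i. i < ?q \<Longrightarrow> bij (\<Omega> ! i)"
    and sharp: "\<And>x. bij_betw (\<lambda>i. (\<Omega> ! i) x) {..<?q} UNIV"
    using \<Omega> by (auto simp: perm_poly_tuple_iff)
  obtain g :: "'a poly poly"
    where g: "reduced g" "eval2 g = (\<lambda>x. c \<circ> inv_into {..<?q} (\<lambda>i. (\<Omega> ! i) x))"
    using ex_reduced_eval2 by blast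
  have bij1: "bij (eval2 g x)" for x
    unfolding g(2) using sharp c by (intro bij_betw_trans[OF bij_betw_inv_into])
  have val: "eval2 g x ((\<Omega> ! i) x) = c i" if "i < ?q" for i x
    using inv_into_f_f[OF bij_betw_imp_inj_on[OF sharp]] that by (simp add: g(2))
  have "inj (\<lambda>x. eval2 g x y)" for y
  proof (rule injI)
    fix x x' assume eq: "eval2 g x y = eval2 g x' y"
    obtain i where i: "i < ?q" "eval2 g x y = c i"
      using c by (metis bij_betw_imp_surj_on imageE lessThan_iff UNIV_I)
    then have "y = (\<Omega> ! i) x" "y = (\<Omega> ! i) x'"
      using bij1 val eq by (metis bij_is_inj injD)+
    then show "x = x'" using bij[OF i(1)] by (metis bij_is_inj injD)
  qed
  then have bij2: "bij (\<lambda>x. eval2 g x y)" for y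
    by (simp add: bij_def finite_UNIV_inj_surj)
  have "poly (subst_fst g x) = eval2 g x" "poly (subst_snd g y) = (\<lambda>x. eval2 g x y)" for x y
    by (auto simp: poly_subst_fst poly_subst_snd)
  then have lpp: "lpp g"
    using g(1) bij1 bij2 by (simp add: lpp_def perm_poly_def)
  have "tuple_of c g ! i = \<Omega> ! i" if "i < ?q" for i
    using eval2_tuple_of[OF lpp that, where c = c] val[OF that] by (intro ext) metis
  then have "tuple_of c g = \<Omega>"
    using len by (intro nth_equalityI) (auto simp: tuple_of_def)
  with lpp show ?thesis by blast
qed

text \<open>Every value is some \<open>c i\<close>, and the tuple records where that value is taken,
  so equal tuples give equal functions.\<close>

lemma tuple_of_inject:
  fixes f g :: "'a::{field,finite} poly poly"
  assumes "lpp f" "lpp g" and c: "bij_betw c {..<CARD('a)} UNIV"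
    and eq: "tuple_of c f = tuple_of c g"
  shows "f = g"
proof (rule reduced_eqI)
  show "reduced f" "reduced g" using assms by (auto simp: lpp_def)
  show "eval2 f = eval2 g"
  proof (intro ext)
    fix x y
    obtain i where "i < CARD('a)" "eval2 f x y = c i"
      using c by (metis bij_betw_imp_surj_on imageE lessThan_iff UNIV_I)
    then show "eval2 f x y = eval2 g x y"
      using eval2_tuple_of[where c = c and i = i and x = x and y = y] assms(1,2) eq by metis
  qed
qed

section \<open>Equivalent tuples that form groups\<close>

text \<open>On the whole type the restricted operations of \<open>BijGroup\<close> are plain
  composition and inversion, so the arguments below can work with functions directly.\<close>

lemma subgroup_Sym_iff:
  "subgroup H Sym \<longleftrightarrow> (\<forall>h\<in>H. bij h) \<and> id \<in> H \<and>
    (\<forall>g\<in>H. \<forall>h\<in>H. g \<circ> h \<in> H) \<and> (\<forall>h\<in>H. inv_into UNIV h \<in> H)"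
proof -
  have carrier: "carrier Sym = {h :: 'a \<Rightarrow> 'a. bij h}"
    by (auto simp: BijGroup_def Bij_def)
  have mult: "g \<otimes>\<^bsub>Sym\<^esub> h = g \<circ> h" if "bij g" "bij h" for g h :: "'a \<Rightarrow> 'a"
    using that by (simp add: BijGroup_def Bij_def compose_def o_def restrict_UNIV)
  have one: "\<one>\<^bsub>Sym\<^esub> = (id :: 'a \<Rightarrow> 'a)"
    by (auto simp: BijGroup_def)
  have minv: "inv\<^bsub>Sym\<^esub> h = inv_into UNIV h" if "bij h" for h :: "'a \<Rightarrow> 'a"
    using that inv_BijGroup[of h UNIV] by (simp add: Bij_def restrict_UNIV)
  show ?thesis
  proof
    assume "subgroup H Sym"
    then interpret subgroup H Sym .
    have "\<forall>h\<in>H. bij h" using subset carrier by auto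
    then show "(\<forall>h\<in>H. bij h) \<and> id \<in> H \<and>
        (\<forall>g\<in>H. \<forall>h\<in>H. g \<circ> h \<in> H) \<and> (\<forall>h\<in>H. inv_into UNIV h \<in> H)"
      using m_closed one_closed m_inv_closed mult one minv by metis
  next
    assume "(\<forall>h\<in>H. bij h) \<and> id \<in> H \<and>
        (\<forall>g\<in>H. \<forall>h\<in>H. g \<circ> h \<in> H) \<and> (\<forall>h\<in>H. inv_into UNIV h \<in> H)"
    then show "subgroup H Sym"
      by unfold_locales (auto simp: carrier mult one minv)
  qed
qed

text \<open>The inner factor \<open>\<mu> \<circ> \<sigma>\<close> of the product is the inverse of
  \<open>h\<close>, by the assumption that \<open>h\<close> is carried to the identity.\<close>

lemma equivalent_group_tuple_mult:
  assumes "bij \<sigma>" "bij \<mu>" and eq: "\<sigma> \<circ> h \<circ> \<mu> = id" and "bij h"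
  shows "(\<sigma> \<circ> g \<circ> \<mu>) \<circ> (\<sigma> \<circ> g' \<circ> \<mu>) = \<sigma> \<circ> (g \<circ> inv_into UNIV h \<circ> g') \<circ> \<mu>"
proof -
  have "\<mu> (\<sigma> x) = inv_into UNIV h x" for x
  proof -
    obtain y where y: "x = h (\<mu> y)" using assms by (metis bij_pointE)
    then have "\<sigma> x = y" using fun_cong[OF eq, of y] by simp
    then show ?thesis using y \<open>bij h\<close> by (simp add: bij_is_inj)
  qed
  then show ?thesis by (auto simp: fun_eq_iff)
qed

text \<open>The common orbit of \<open>z\<close> fixes the index \<open>m\<close> of the identity,
  and \<open>\<Omega>\<close> with \<open>m\<close> fixes the index of each product. Hence both
  tuples multiply by the same rule on indices, and evaluating products at \<open>z\<close> yields
  all their values.\<close>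

lemma equivalent_group_tuple_eqI:
  fixes \<Omega> \<Gamma> \<Gamma>' :: "('a::finite \<Rightarrow> 'a) list"
  assumes "subgroup (set \<Omega>) Sym" "subgroup (set \<Gamma>) Sym" "subgroup (set \<Gamma>') Sym"
    and "tuple_equiv \<Omega> \<Gamma>" "tuple_equiv \<Omega> \<Gamma>'"
    and eq: "\<And>i. i < CARD('a) \<Longrightarrow> (\<Gamma> ! i) z = (\<Gamma>' ! i) z"
  shows "\<Gamma> = \<Gamma>'"
proof -
  let ?q = "CARD('a)"
  have len: "length \<Omega> = ?q" "length \<Gamma> = ?q" "length \<Gamma>' = ?q"
    using assms by (auto simp: tuple_equiv_def perm_poly_tuple_def)
  have orbit: "bij_betw (\<lambda>i. (\<Gamma> ! i) z) {..<?q} UNIV"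
    using assms by (auto simp: tuple_equiv_def perm_poly_tuple_iff)
  obtain m where m: "m < ?q" "(\<Gamma> ! m) z = z"
    using orbit by (metis bij_betw_imp_surj_on imageE lessThan_iff UNIV_I)
  have mult: "\<Delta> ! i \<circ> \<Delta> ! j = \<Delta> ! k"
    if \<Delta>: "subgroup (set \<Delta>) Sym" "tuple_equiv \<Omega> \<Delta>" "(\<Delta> ! m) z = z"
      and ijk: "i < ?q" "j < ?q" "k < ?q" "\<Omega> ! k = \<Omega> ! i \<circ> inv_into UNIV (\<Omega> ! m) \<circ> \<Omega> ! j"
    for \<Delta> i j k
  proof -
    obtain \<sigma> \<mu> where \<sigma>\<mu>: "bij \<sigma>" "bij \<mu>" "map (\<lambda>\<beta>. \<sigma> \<circ> \<beta> \<circ> \<mu>) \<Omega> = \<Delta>"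
      using \<Delta>(2) by (auto simp: tuple_equiv_def)
    have nth: "\<Delta> ! i = \<sigma> \<circ> \<Omega> ! i \<circ> \<mu>" if "i < ?q" for i
      using \<sigma>\<mu>(3) len that by auto
    have len\<Delta>: "length \<Delta> = ?q" using \<sigma>\<mu>(3) len by auto
    have "id \<in> set \<Delta>" using \<Delta>(1) by (simp add: subgroup_Sym_iff)
    then obtain l where l: "l < ?q" "\<Delta> ! l = id"
      using len\<Delta> by (metis in_set_conv_nth)
    have "inj_on (\<lambda>i. (\<Delta> ! i) z) {..<?q}"
      using \<Delta>(2) by (auto simp: tuple_equiv_def perm_poly_tuple_iff bij_betw_def)
    \<comment> \<open>Both entries fix \<open>z\<close>, and sharp transitivity allows only one
      index for that.\<close>
    then have "l = m" using l m(1) \<Delta>(3) by (auto simp: inj_on_def)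
    then have "\<sigma> \<circ> \<Omega> ! m \<circ> \<mu> = id" using l nth m by simp
    moreover have "bij (\<Omega> ! m)"
      using assms(1) m(1) len by (simp add: subgroup_Sym_iff)
    ultimately have "(\<sigma> \<circ> \<Omega> ! i \<circ> \<mu>) \<circ> (\<sigma> \<circ> \<Omega> ! j \<circ> \<mu>) = \<sigma> \<circ> \<Omega> ! k \<circ> \<mu>"
      unfolding ijk(4) by (rule equivalent_group_tuple_mult[OF \<sigma>\<mu>(1,2)])
    then show ?thesis using nth ijk(1-3) by simp
  qed
  have "(\<Gamma> ! i) x = (\<Gamma>' ! i) x" if i: "i < ?q" for i x
  proof -
    obtain j where j: "j < ?q" "x = (\<Gamma> ! j) z"
      using orbit by (metis bij_betw_imp_surj_on imageE lessThan_iff UNIV_I)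
    have "\<Omega> ! i \<circ> inv_into UNIV (\<Omega> ! m) \<circ> \<Omega> ! j \<in> set \<Omega>"
      using assms(1) i j(1) m(1) len by (simp add: subgroup_Sym_iff)
    then obtain k where k: "k < ?q" "\<Omega> ! k = \<Omega> ! i \<circ> inv_into UNIV (\<Omega> ! m) \<circ> \<Omega> ! j"
      using len by (metis in_set_conv_nth)
    have "(\<Gamma> ! i) ((\<Gamma> ! j) z) = (\<Gamma> ! k) z"
      using mult[OF assms(2,4) m(2) i j(1) k] by (metis comp_apply)
    moreover have "(\<Gamma>' ! m) z = z" using m eq by simp
    then have "(\<Gamma>' ! i) ((\<Gamma>' ! j) z) = (\<Gamma>' ! k) z"
      using mult[OF assms(3,5) _ i j(1) k] by (metis comp_apply)
    ultimately show ?thesis using eq j k by simp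
  qed
  then show ?thesis using len by (intro nth_equalityI) auto
qed

text \<open>Left translation by \<open>h\<close> puts the identity at the index \<open>m\<close>
  with \<open>\<phi> m = z\<close>, as a sharply transitive group requires; conjugation by
  \<open>\<nu>\<close> then relabels the points so that the orbit of \<open>z\<close> becomes
  \<open>\<phi>\<close>.\<close>

lemma ex_equivalent_group_tuple:
  fixes \<Omega> :: "('a::finite \<Rightarrow> 'a) list"
  assumes \<Omega>: "perm_poly_tuple \<Omega>" and H: "subgroup (set \<Omega>) Sym"
    and \<phi>: "bij_betw \<phi> {..<CARD('a)} UNIV"
  shows "\<exists>\<Gamma>. tuple_equiv \<Omega> \<Gamma> \<and> subgroup (set \<Gamma>) Sym \<and> (\<forall>i<CARD('a). (\<Gamma> ! i) z = \<phi> i)"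
proof -
  let ?q = "CARD('a)"
  have len: "length \<Omega> = ?q" and bij: "\<And>\<beta>. \<beta> \<in> set \<Omega> \<Longrightarrow> bij \<beta>"
    and sharp: "\<And>x. bij_betw (\<lambda>i. (\<Omega> ! i) x) {..<?q} UNIV"
    using \<Omega> by (auto simp: perm_poly_tuple_iff)
  obtain m where m: "m < ?q" "\<phi> m = z"
    using \<phi> by (metis bij_betw_imp_surj_on imageE lessThan_iff UNIV_I)
  define h where "h = inv_into UNIV (\<Omega> ! m)"
  have bij_m: "bij (\<Omega> ! m)" using bij m len by simp
  have bij_h: "bij h" unfolding h_def using bij_m by (rule bij_imp_bij_inv)
  have h_m: "h ((\<Omega> ! m) x) = x" for x
    unfolding h_def using bij_m by (simp add: bij_is_inj)
  have "bij_betw (h \<circ> (\<lambda>i. (\<Omega> ! i) z)) {..<?q} UNIV"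
    using sharp bij_h by (rule bij_betw_trans)
  then have D: "bij_betw (\<lambda>i. h ((\<Omega> ! i) z)) {..<?q} UNIV" by (simp add: o_def)
  define \<nu> where "\<nu> = \<phi> \<circ> inv_into {..<?q} (\<lambda>i. h ((\<Omega> ! i) z))"
  have bij_\<nu>: "bij \<nu>"
    unfolding \<nu>_def using D \<phi> by (intro bij_betw_trans[OF bij_betw_inv_into])
  have \<nu>: "\<nu> (h ((\<Omega> ! i) z)) = \<phi> i" if "i < ?q" for i
    using inv_into_f_f[OF bij_betw_imp_inj_on[OF D]] that by (simp add: \<nu>_def)
  define \<mu> where "\<mu> = inv_into UNIV \<nu>"
  have bij_\<mu>: "bij \<mu>" unfolding \<mu>_def using bij_\<nu> by (rule bij_imp_bij_inv)
  have \<mu>\<nu>: "\<mu> (\<nu> x) = x" "\<nu> (\<mu> x) = x" for x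
    using bij_\<nu> by (auto simp: \<mu>_def bij_is_inj bij_is_surj surj_f_inv_f)
  \<comment> \<open>The entry at \<open>m\<close> becomes the identity after translation, so its
    instance of the defining property of \<open>\<nu>\<close> says that the base point is
    kept.\<close>
  have "\<nu> z = z" using \<nu>[OF m(1)] m(2) h_m by simp
  then have \<mu>z: "\<mu> z = z" using \<mu>\<nu>(1)[of z] by simp
  define \<Gamma> where "\<Gamma> = map (\<lambda>\<beta>. (\<nu> \<circ> h) \<circ> \<beta> \<circ> \<mu>) \<Omega>"
  have nth: "\<Gamma> ! i = (\<nu> \<circ> h) \<circ> \<Omega> ! i \<circ> \<mu>" if "i < ?q" for i
    using that len by (simp add: \<Gamma>_def)
  have bij_\<nu>h: "bij (\<nu> \<circ> h)" using bij_h bij_\<nu> by (rule bij_comp)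
  have val: "\<forall>i<?q. (\<Gamma> ! i) z = \<phi> i" using nth \<nu> \<mu>z by simp
  have "perm_poly_tuple \<Gamma>"
    unfolding perm_poly_tuple_iff
  proof (intro conjI ballI allI)
    show "length \<Gamma> = ?q" by (simp add: \<Gamma>_def len)
    show "bij \<gamma>" if "\<gamma> \<in> set \<Gamma>" for \<gamma>
      using that bij bij_\<nu>h bij_\<mu> by (auto simp: \<Gamma>_def intro!: bij_comp)
    show "bij_betw (\<lambda>i. (\<Gamma> ! i) x) {..<?q} UNIV" for x
    proof -
      have "bij_betw ((\<nu> \<circ> h) \<circ> (\<lambda>i. (\<Omega> ! i) (\<mu> x))) {..<?q} UNIV"
        using sharp bij_\<nu>h by (rule bij_betw_trans)
      then show ?thesis by (rule bij_betw_cong[THEN iffD1, rotated]) (simp add: nth)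
    qed
  qed
  then have equiv: "tuple_equiv \<Omega> \<Gamma>"
    using \<Omega> bij_\<nu>h bij_\<mu> unfolding tuple_equiv_def \<Gamma>_def by blast
  note H' = H[unfolded subgroup_Sym_iff]
  have h_in: "h \<in> set \<Omega>" "\<Omega> ! m \<in> set \<Omega>" using H' m len by (auto simp: h_def)
  \<comment> \<open>Translation by the group element \<open>h\<close> permutes the group, so only
    the conjugation by \<open>\<nu>\<close> is visible on the set.\<close>
  have set_\<Gamma>: "set \<Gamma> = (\<lambda>\<beta>. \<nu> \<circ> \<beta> \<circ> \<mu>) ` set \<Omega>"
  proof (intro equalityI subsetI)
    fix \<gamma> assume "\<gamma> \<in> set \<Gamma>"
    then obtain \<beta> where "\<beta> \<in> set \<Omega>" "\<gamma> = \<nu> \<circ> (h \<circ> \<beta>) \<circ> \<mu>" by (auto simp: \<Gamma>_def o_assoc)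
    then show "\<gamma> \<in> (\<lambda>\<beta>. \<nu> \<circ> \<beta> \<circ> \<mu>) ` set \<Omega>" using H' h_in by blast
  next
    fix \<gamma> assume "\<gamma> \<in> (\<lambda>\<beta>. \<nu> \<circ> \<beta> \<circ> \<mu>) ` set \<Omega>"
    then obtain \<beta> where \<beta>: "\<beta> \<in> set \<Omega>" "\<gamma> = \<nu> \<circ> \<beta> \<circ> \<mu>" by auto
    then have "\<gamma> = (\<nu> \<circ> h) \<circ> (\<Omega> ! m \<circ> \<beta>) \<circ> \<mu>" by (auto simp: h_m fun_eq_iff)
    then show "\<gamma> \<in> set \<Gamma>" using H' h_in \<beta>(1) by (auto simp: \<Gamma>_def)
  qed
  have "subgroup (set \<Gamma>) Sym"
    unfolding subgroup_Sym_iff set_\<Gamma>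
  proof (intro conjI ballI)
    show "bij \<gamma>" if "\<gamma> \<in> (\<lambda>\<beta>. \<nu> \<circ> \<beta> \<circ> \<mu>) ` set \<Omega>" for \<gamma>
      using that bij bij_\<nu> bij_\<mu> by (auto intro!: bij_comp)
    show "id \<in> (\<lambda>\<beta>. \<nu> \<circ> \<beta> \<circ> \<mu>) ` set \<Omega>"
      using H' by (intro image_eqI[of _ _ id]) (auto simp: \<mu>\<nu>)
    show "\<gamma> \<circ> \<gamma>' \<in> (\<lambda>\<beta>. \<nu> \<circ> \<beta> \<circ> \<mu>) ` set \<Omega>"
      if \<gamma>: "\<gamma> \<in> (\<lambda>\<beta>. \<nu> \<circ> \<beta> \<circ> \<mu>) ` set \<Omega>" "\<gamma>' \<in> (\<lambda>\<beta>. \<nu> \<circ> \<beta> \<circ> \<mu>) ` set \<Omega>" for \<gamma> \<gamma>'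
    proof -
      obtain \<beta> \<beta>' where "\<beta> \<in> set \<Omega>" "\<beta>' \<in> set \<Omega>" "\<gamma> = \<nu> \<circ> \<beta> \<circ> \<mu>" "\<gamma>' = \<nu> \<circ> \<beta>' \<circ> \<mu>"
        using \<gamma> by auto
      then show ?thesis
        using H' by (intro image_eqI[of _ _ "\<beta> \<circ> \<beta>'"]) (auto simp: \<mu>\<nu> fun_eq_iff)
    qed
    show "inv_into UNIV \<gamma> \<in> (\<lambda>\<beta>. \<nu> \<circ> \<beta> \<circ> \<mu>) ` set \<Omega>"
      if \<gamma>: "\<gamma> \<in> (\<lambda>\<beta>. \<nu> \<circ> \<beta> \<circ> \<mu>) ` set \<Omega>" for \<gamma>
    proof -
      obtain \<beta> where \<beta>: "\<beta> \<in> set \<Omega>" "\<gamma> = \<nu> \<circ> \<beta> \<circ> \<mu>" using \<gamma> by auto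
      have "inv_into UNIV \<gamma> = \<nu> \<circ> inv_into UNIV \<beta> \<circ> \<mu>"
        using bij[OF \<beta>(1)] unfolding \<beta>(2)
        by (intro inv_unique_comp)
          (auto simp: \<mu>\<nu> fun_eq_iff bij_is_inj bij_is_surj surj_f_inv_f)
      then show ?thesis using H' \<beta>(1) by blast
    qed
  qed
  with equiv val show ?thesis by blast
qed

section \<open>Counting by restriction to the line \<open>X_1 = 0\<close>\<close>

lemma bij_betw_eval2_zero:
  fixes c :: "nat \<Rightarrow> 'a::{field,finite}"
  assumes c: "bij_betw c {..<CARD('a)} UNIV" and f: "perm_group_poly c f"
  shows "bij_betw (\<lambda>g. eval2 g 0) {g. perm_group_poly c g \<and> lpp_equiv c f g} {\<pi>. bij \<pi>}"
    (is "bij_betw _ ?S _")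
proof -
  have lpp_f: "lpp f" and H: "subgroup (set (tuple_of c f)) Sym"
    using f by (auto simp: perm_group_poly_def)
  have mem: "lpp g" "subgroup (set (tuple_of c g)) Sym" "tuple_equiv (tuple_of c f) (tuple_of c g)"
    if "g \<in> ?S" for g
    using that by (auto simp: perm_group_poly_def lpp_equiv_def)
  have "inj_on (\<lambda>g. eval2 g 0) ?S"
  proof (rule inj_onI)
    fix g g' assume g: "g \<in> ?S" and g': "g' \<in> ?S" and eq: "eval2 g 0 = eval2 g' 0"
    \<comment> \<open>The i-th entry at 0 is the point where the restriction to the line takes the
      value \<open>c i\<close>.\<close>
    have "(tuple_of c g ! i) 0 = (tuple_of c g' ! i) 0" if i: "i < CARD('a)" for i
      using eval2_tuple_of[OF mem(1)[OF g] i, where c = c and x = 0 and y = "(tuple_of c g ! i) 0"]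
        eval2_tuple_of[OF mem(1)[OF g'] i, where c = c and x = 0 and y = "(tuple_of c g ! i) 0"] eq
      by simp
    then have "tuple_of c g = tuple_of c g'"
      by (rule equivalent_group_tuple_eqI
          [OF H mem(2)[OF g] mem(2)[OF g'] mem(3)[OF g] mem(3)[OF g']])
    with mem(1)[OF g] mem(1)[OF g'] c show "g = g'" by (rule tuple_of_inject)
  qed
  moreover have "bij (eval2 g 0)" if "g \<in> ?S" for g
  proof -
    have "poly (subst_fst g 0) = eval2 g 0" by (auto simp: poly_subst_fst)
    then show ?thesis using mem(1)[OF that] by (metis lpp_def perm_poly_def)
  qed
  moreover have "\<exists>g\<in>?S. eval2 g 0 = \<pi>" if \<pi>: "bij \<pi>" for \<pi>
  proof -
    \<comment> \<open>The restriction equals \<open>\<pi>\<close> exactly when the i-th entry sends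
      0 to the preimage of \<open>c i\<close> under \<open>\<pi>\<close>; this is the orbit to
      prescribe.\<close>
    have "bij_betw (inv_into UNIV \<pi> \<circ> c) {..<CARD('a)} UNIV"
      using c bij_imp_bij_inv[OF \<pi>] by (rule bij_betw_trans)
    then obtain \<Gamma> where \<Gamma>: "tuple_equiv (tuple_of c f) \<Gamma>" "subgroup (set \<Gamma>) Sym"
      "\<And>i. i < CARD('a) \<Longrightarrow> (\<Gamma> ! i) 0 = inv_into UNIV \<pi> (c i)"
      using ex_equivalent_group_tuple[OF perm_poly_tuple_tuple_of[OF lpp_f c] H, of _ 0]
      by (metis comp_apply)
    obtain g where g: "lpp g" "tuple_of c g = \<Gamma>"
      using ex_lpp_tuple_of \<Gamma>(1) c unfolding tuple_equiv_def by blast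
    have "eval2 g 0 y = \<pi> y" for y
    proof -
      obtain i where i: "i < CARD('a)" "\<pi> y = c i"
        using c by (metis bij_betw_imp_surj_on imageE lessThan_iff UNIV_I)
      then have "y = (\<Gamma> ! i) 0" using \<Gamma>(3) \<pi> by (metis bij_inv_eq_iff)
      then show ?thesis using eval2_tuple_of[OF g(1) i(1), where c = c] g(2) i(2) by metis
    qed
    moreover have "g \<in> ?S"
      using g \<Gamma> lpp_f by (simp add: perm_group_poly_def lpp_equiv_def)
    ultimately show ?thesis by blast
  qed
  ultimately show ?thesis unfolding bij_betw_def by blast
qed

theorem theorem4p12:
  fixes p n e :: nat
    and c :: "nat \<Rightarrow> 'a::{field,finite}"
    and f :: "'a poly poly"
  assumes "prime p" and "n \<ge> 1" and "e < n"
    and "CARD('a) = p ^ n"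
    and "bij_betw c {..<p ^ n} UNIV"
    and "klenian c p e f"
  shows "card {g. perm_group_poly c g \<and> lpp_equiv c f g} = fact (p ^ n)"
proof -
  have "card {g. perm_group_poly c g \<and> lpp_equiv c f g} = card {\<pi> :: 'a \<Rightarrow> 'a. bij \<pi>}"
    using assms by (intro bij_betw_same_card[OF bij_betw_eval2_zero]) (auto simp: klenian_def)
  also have "{\<pi> :: 'a \<Rightarrow> 'a. bij \<pi>} = {\<pi>. \<pi> permutes UNIV}"
    by (auto simp: permutes_bij intro: bij_imp_permutes)
  finally show ?thesis
    using card_permutations[of "UNIV :: 'a set" "p ^ n"] assms by simp
qed

end
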